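(* Let $f:\mathbb{T}^{\infty}\to\mathbb{R}$ be a measurable function that is Lipschitz with respect to the Euclidean metric $\mathrm{dist}$. Then there exists $a\in\mathbb{R}$ with the following property: for every $\varepsilon>0$ there exists a parallel infinite-dimensional subtorus $M\subseteq\mathbb{T}^{\infty}$ such that $\|f-a\|_{L^{\infty}(M)}<\varepsilon$.
   Context: $\mathbb{T}=\mathbb{R}/\mathbb{Z}$ and $\mathbb{T}^{\infty}=\mathbb{T}^{\mathbb{N}}$ is the set of sequences $x=(x_i)_{i\ge1}$ with $x_i\in\mathbb{T}$. Let $\sigma$ be the uniform probability measure on $\mathbb{T}^{\infty}$ (the complete product of Lebesgue/Haar probability measures on the circle); "measurable" refers to $\sigma$. For $x,y\in\mathbb{T}^\infty$, $\mathrm{dist}(x,y)=\sqrt{\sum_{i\ge1}\mathrm{dist}^2(x_i,y_i)}$, where $\mathrm{dist}(x_i,y_i)$ is the distance in the circle $\mathbb{R}/\mathbb{Z}$; this may equal $+\infty$. $f$ is Lipschitz if $|f(x)-f(y)|\le L\,\mathrm{dist}(x,y)$ for some $L$ and all $x,y$. A parallel infinite-dimensional subtorus is a set $M=\{x\in\mathbb{T}^\infty:\ x_i=b_i \text{ for all } i\in\mathbb{N}\setminus A\}$ for some infinite $A\subseteq\mathbb{N}$ and some $b:\mathbb{N}\setminus A\to\mathbb{T}$; $M$ carries its uniform (product) probability measure, with respect to which $L^\infty(M)$ is taken. *)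

theory Defs
  imports "HOL-Probability.Probability"
begin

text \<open>The circle T = R/Z is represented by the half-open interval [0,1);
  the infinite torus by sequences nat => real with values in [0,1).\<close>

definition circ :: "real set" where
  "circ = {0..<1}"

definition circ_measure :: "real measure" where
  "circ_measure = uniform_measure lborel circ"

definition torus_measure :: "nat set \<Rightarrow> (nat \<Rightarrow> real) measure" where
  "torus_measure I = PiM I (\<lambda>_. circ_measure)"

definition sigma_T :: "(nat \<Rightarrow> real) measure" where
  "sigma_T = completion (torus_measure UNIV)"

definition circ_dist :: "real \<Rightarrow> real \<Rightarrow> real" where
  "circ_dist s t = min (frac (s - t)) (frac (t - s))"

text \<open>Finiteness of the l2-distance, and its value when finite.\<close>
definition finite_tdist :: "(nat \<Rightarrow> real) \<Rightarrow> (nat \<Rightarrow> real) \<Rightarrow> bool" where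
  "finite_tdist x y \<longleftrightarrow> summable (\<lambda>i. (circ_dist (x i) (y i))\<^sup>2)"

definition tdist :: "(nat \<Rightarrow> real) \<Rightarrow> (nat \<Rightarrow> real) \<Rightarrow> real" where
  "tdist x y = sqrt (\<Sum>i. (circ_dist (x i) (y i))\<^sup>2)"

text \<open>Lipschitz w.r.t. the (possibly infinite) metric: the inequality is only
  a constraint for pairs at finite distance.\<close>
definition torus_lipschitz :: "((nat \<Rightarrow> real) \<Rightarrow> real) \<Rightarrow> bool" where
  "torus_lipschitz f \<longleftrightarrow> (\<exists>L. \<forall>x\<in>space sigma_T. \<forall>y\<in>space sigma_T.
      finite_tdist x y \<longrightarrow> \<bar>f x - f y\<bar> \<le> L * tdist x y)"

definition subtorus_emb :: "nat set \<Rightarrow> (nat \<Rightarrow> real) \<Rightarrow> (nat \<Rightarrow> real) \<Rightarrow> (nat \<Rightarrow> real)" where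
  "subtorus_emb A b y = (\<lambda>i. if i \<in> A then y i else b i)"

text \<open>L^infinity(M)-norm of g on the parallel subtorus M given by (A,b) is < eps:
  there is delta < eps with |g| <= delta almost everywhere w.r.t. the (completed)
  uniform product measure on M.\<close>
definition linf_subtorus_less :: "nat set \<Rightarrow> (nat \<Rightarrow> real) \<Rightarrow> ((nat \<Rightarrow> real) \<Rightarrow> real) \<Rightarrow> real \<Rightarrow> bool" where
  "linf_subtorus_less A b g eps \<longleftrightarrow>
     (\<exists>\<delta><eps. AE y in completion (torus_measure A). \<bar>g (subtorus_emb A b y)\<bar> \<le> \<delta>)"

end

theory Submission
  imports Defs
begin

text \<open>
  For independent uniform \<open>x\<close>, \<open>y\<close> and a set \<open>S\<close> of coordinates let \<open>z\<^sub>S\<close> be the point that agrees with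
  \<open>y\<close> on \<open>S\<close> and with \<open>x\<close> off \<open>S\<close>; it is again uniform. By approximation with cylinder functions,
  \<open>f z\<^sub>S\<close> and \<open>f z\<^sub>T\<close> are close in probability, uniformly over all \<open>S\<close>, \<open>T\<close> that agree on a long enough
  initial segment. Hence adding a sufficiently large index \<open>n\<close> to a finite set \<open>F\<close> changes \<open>f z\<^sub>F\<close> little
  with high probability. Only finitely many coordinates of \<open>y\<close> are involved, every box of fixed radius
  in them has measure bounded below, and \<open>f\<close> is Lipschitz, so for most \<open>x\<close> the change is small for
  \<^emph>\<open>every\<close> \<open>y\<close>. Adding indices one at a time with summable errors yields an infinite set \<open>A\<close> such that,
  for at least half of all \<open>x\<close>, the function \<open>f\<close> is within \<open>\<epsilon>\<close> of \<open>f x\<close> almost everywhere on the subtorus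
  through \<open>x\<close> in the directions \<open>A\<close>. As \<open>x\<close> can be chosen with \<open>f x\<close> bounded independently of \<open>\<epsilon>\<close>, a
  limit point of these values as \<open>\<epsilon>\<close> tends to zero is the required constant.
\<close>

section \<open>Product measures and mixtures of two points\<close>

abbreviation torus :: "(nat \<Rightarrow> real) measure" where
  "torus \<equiv> torus_measure UNIV"

abbreviation torus2 :: "((nat \<Rightarrow> real) \<times> (nat \<Rightarrow> real)) measure" where
  "torus2 \<equiv> torus \<Otimes>\<^sub>M torus"

text \<open>With the first component fixed, varying the second runs through the subtorus through
  that point in the directions \<open>S\<close>.\<close>

abbreviation mix :: "nat set \<Rightarrow> (nat \<Rightarrow> real) \<times> (nat \<Rightarrow> real) \<Rightarrow> (nat \<Rightarrow> real)" where
  "mix S p \<equiv> subtorus_emb S (fst p) (snd p)"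

lemma emeasure_lborel_circ: "emeasure lborel circ = 1"
  by (simp add: circ_def)

lemma sets_circ_measure [measurable_cong]: "sets circ_measure = sets borel"
  by (simp add: circ_measure_def)

text \<open>The measure lives on the whole line and is concentrated on \<open>circ\<close>. Hence
  the space of \<open>torus\<close> consists of all real sequences, and lying in \<open>circ\<close>
  is only an almost sure property of the coordinates.\<close>

lemma space_circ_measure [simp]: "space circ_measure = UNIV"
  by (simp add: circ_measure_def)

interpretation circ: prob_space circ_measure
  unfolding circ_measure_def
  by (rule prob_space_uniform_measure) (simp_all add: emeasure_lborel_circ)

interpretation circ_prod: product_prob_space "\<lambda>_::nat. circ_measure" I for I
  by unfold_locales

interpretation subtorus: prob_space "torus_measure A" for A
  unfolding torus_measure_def by (rule prob_space_PiM) (rule circ.prob_space_axioms)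

interpretation torus2: pair_prob_space torus torus
  by unfold_locales

lemma space_torus [simp]: "space torus = UNIV"
  by (simp add: torus_measure_def space_PiM)

lemma space_torus2 [simp]: "space torus2 = UNIV"
  by (simp add: space_pair_measure)

lemma sets_torus_measure [measurable_cong]:
  "sets (torus_measure A) = sets (PiM A (\<lambda>_. circ_measure))"
  by (simp add: torus_measure_def)

lemma measurable_mix [measurable]: "mix S \<in> torus2 \<rightarrow>\<^sub>M torus"
proof -
  have "(\<lambda>p. mix S p i) \<in> torus2 \<rightarrow>\<^sub>M circ_measure" for i
    unfolding subtorus_emb_def torus_measure_def by (cases "i \<in> S") simp_all
  then show ?thesis
    unfolding torus_measure_def[of UNIV] by (intro measurable_PiM_single') auto
qed

lemma measurable_subtorus_emb: "subtorus_emb A b \<in> torus_measure A \<rightarrow>\<^sub>M torus"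
proof -
  have "(\<lambda>y. subtorus_emb A b y i) \<in> torus_measure A \<rightarrow>\<^sub>M circ_measure" for i
    unfolding subtorus_emb_def torus_measure_def
    by (cases "i \<in> A") (simp_all add: measurable_component_singleton)
  then show ?thesis
    unfolding torus_measure_def[of UNIV] by (intro measurable_PiM_single') auto
qed

lemma emeasure_torus_cylinder:
  assumes "finite J" "\<And>i. i \<in> J \<Longrightarrow> X i \<in> sets borel"
  shows "emeasure torus {z. \<forall>i\<in>J. z i \<in> X i} = (\<Prod>i\<in>J. emeasure circ_measure (X i))"
  using circ_prod.emeasure_PiM_Collect[of J UNIV X] assms
  by (simp add: torus_measure_def sets_circ_measure space_PiM)

lemma sets_torus_cylinder:
  assumes "finite J" "\<And>i. i \<in> J \<Longrightarrow> X i \<in> sets borel"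
  shows "{z. \<forall>i\<in>J. z i \<in> X i} \<in> sets torus"
proof -
  have "{z. \<forall>i\<in>J. z i \<in> X i} = prod_emb UNIV (\<lambda>_. circ_measure) J (Pi\<^sub>E J X)"
    by (auto simp: prod_emb_def PiE_iff)
  also have "\<dots> \<in> sets torus"
    unfolding torus_measure_def using assms by (intro sets_PiM_I) (auto simp: sets_circ_measure)
  finally show ?thesis .
qed

text \<open>Cylinder probabilities determine the product measure. The preimage of a cylinder is a
  rectangle: coordinates outside \<open>S\<close> constrain only the first point, those in
  \<open>S\<close> only the second, so its measure factors over \<open>J\<close>.\<close>

lemma distr_mix: "distr torus2 torus (mix S) = torus"
proof -
  have "distr torus2 torus (mix S) = PiM UNIV (\<lambda>_. circ_measure)"
  proof (rule circ_prod.PiM_eq)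
    show "sets (distr torus2 torus (mix S)) = sets (PiM UNIV (\<lambda>_. circ_measure))"
      by (simp add: torus_measure_def)
  next
    fix J :: "nat set" and X :: "nat \<Rightarrow> real set"
    assume J: "finite J" "\<And>j. j \<in> J \<Longrightarrow> X j \<in> sets circ_measure"
    define C where "C K = {z. \<forall>i\<in>K. z i \<in> X i}" for K
    have eq: "prod_emb UNIV (\<lambda>_. circ_measure) J (Pi\<^sub>E J X) = C J"
      by (auto simp: prod_emb_def PiE_iff C_def)
    have C: "C K \<in> sets torus" "emeasure torus (C K) = (\<Prod>i\<in>K. emeasure circ_measure (X i))"
      if "K \<subseteq> J" for K
      unfolding C_def using that J finite_subset[of K J]
      by (auto intro!: sets_torus_cylinder emeasure_torus_cylinder simp: sets_circ_measure)
    have "emeasure (distr torus2 torus (mix S)) (C J) = emeasure torus2 (mix S -` C J)"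
      using C[of J] by (subst emeasure_distr) auto
    also have "mix S -` C J = C (J - S) \<times> C (J \<inter> S)"
      by (auto simp: C_def subtorus_emb_def)
    also have "emeasure torus2 \<dots> = emeasure torus (C (J - S)) * emeasure torus (C (J \<inter> S))"
      by (intro subtorus.emeasure_pair_measure_Times C) auto
    also have "\<dots> = (\<Prod>i\<in>J. emeasure circ_measure (X i))"
      using J prod.Int_Diff[of J "\<lambda>i. emeasure circ_measure (X i)" S] C[of "J - S"] C[of "J \<inter> S"]
      by (simp add: mult.commute)
    finally show "emeasure (distr torus2 torus (mix S))
        (prod_emb UNIV (\<lambda>_. circ_measure) J (Pi\<^sub>E J X)) = (\<Prod>j\<in>J. emeasure circ_measure (X j))"
      by (simp add: eq)
  qed
  then show ?thesis by (simp add: torus_measure_def)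
qed

lemma sets_mix_vimage: "E \<in> sets torus \<Longrightarrow> {p. mix S p \<in> E} \<in> sets torus2"
  using measurable_sets[OF measurable_mix, of E S] by (simp add: vimage_def)

lemma measure_mix_vimage:
  "E \<in> sets torus \<Longrightarrow> measure torus2 {p. mix S p \<in> E} = measure torus E"
  using measure_distr[OF measurable_mix, of E S] by (simp add: distr_mix vimage_def)

lemma null_sets_mix_vimage:
  assumes "E \<in> null_sets torus"
  shows "{p. mix S p \<in> E} \<in> null_sets torus2"
proof -
  have E: "E \<in> null_sets (distr torus2 torus (mix S))"
    using assms by (simp add: distr_mix)
  show ?thesis
    using null_sets_distr_iff[OF measurable_mix, of E S] E by (simp add: vimage_def)
qed

section \<open>Stability of mixtures under changes at large indices\<close>

text \<open>The property holds for one-coordinate events, whose difference event is empty once the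
  sets agree at that coordinate, and is preserved by complements and countable unions.\<close>

lemma mix_sets_stable:
  assumes "E \<in> sets torus" "0 < \<epsilon>"
  shows "\<exists>N. \<forall>S S'. S \<inter> {..<N} = S' \<inter> {..<N} \<longrightarrow>
    measure torus2 {p. mix S p \<in> E \<and> mix S' p \<notin> E} < \<epsilon>"
proof -
  have "E \<in> sigma_sets UNIV {{f. f i \<in> X} | (i::nat) X. X \<in> sets circ_measure}"
    using assms(1) by (simp add: torus_measure_def sets_PiM_single)
  then show ?thesis using assms(2)
  proof (induction arbitrary: \<epsilon>)
    case (Basic a)
    then obtain i X where a: "a = {f. f i \<in> X}" by auto
    have empty: "{p. mix S p \<in> a \<and> mix S' p \<notin> a} = {}" if "S \<inter> {..<Suc i} = S' \<inter> {..<Suc i}" for S S'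
    proof -
      have "i \<in> S \<longleftrightarrow> i \<in> S'" using that by auto
      then show ?thesis by (auto simp: a subtorus_emb_def)
    qed
    have "measure torus2 {p. mix S p \<in> a \<and> mix S' p \<notin> a} < \<epsilon>"
      if "S \<inter> {..<Suc i} = S' \<inter> {..<Suc i}" for S S'
      by (simp only: empty[OF that] measure_empty Basic.prems)
    then show ?case by blast
  next
    case Empty
    then show ?case by simp
  next
    case (Compl a)
    obtain N where N: "\<And>S S'. S \<inter> {..<N} = S' \<inter> {..<N} \<Longrightarrow>
        measure torus2 {p. mix S p \<in> a \<and> mix S' p \<notin> a} < \<epsilon>"
      using Compl by blast
    have "measure torus2 {p. mix S p \<in> UNIV - a \<and> mix S' p \<notin> UNIV - a} < \<epsilon>"
      if "S \<inter> {..<N} = S' \<inter> {..<N}" for S S'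
    proof -
      \<comment> \<open>The condition on the two sets is symmetric, so complementing the event
        merely exchanges their roles.\<close>
      have "{p. mix S p \<in> UNIV - a \<and> mix S' p \<notin> UNIV - a} = {p. mix S' p \<in> a \<and> mix S p \<notin> a}"
        by auto
      then show ?thesis using N[OF that[symmetric]] by simp
    qed
    then show ?case by blast
  next
    case (Union a)
    have a [measurable]: "a i \<in> sets torus" for i
      using Union(1)[of i] by (simp add: torus_measure_def sets_PiM_single)
    \<comment> \<open>\<open>R m\<close> is the part of the union missed by the first
      \<open>m\<close> events. It receives half of \<epsilon>; the first \<open>m\<close> events
      share the other half.\<close>
    define R where "R m = (\<Union>i. a i) - (\<Union>i<m. a i)" for m
    have R [measurable]: "R m \<in> sets torus" for m
      by (simp add: R_def)
    have "(\<lambda>m. measure torus (R m)) \<longlonglongrightarrow> measure torus (\<Inter>m. R m)"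
      by (rule subtorus.finite_Lim_measure_decseq) (auto simp: decseq_def R_def dest: order.strict_trans2)
    also have "(\<Inter>m. R m) = {}"
      by (auto simp: R_def)
    finally have "(\<lambda>m. measure torus (R m)) \<longlonglongrightarrow> 0" by simp
    then have "\<forall>\<^sub>F m in sequentially. measure torus (R m) < \<epsilon> / 2"
      using \<open>0 < \<epsilon>\<close> by (intro order_tendstoD(2)) auto
    then obtain m where m: "measure torus (R m) < \<epsilon> / 2"
      by (auto simp: eventually_sequentially)
    \<comment> \<open>\<open>Suc m\<close> keeps the share positive even for
      \<open>m = 0\<close>.\<close>
    have "\<forall>i. \<exists>N. \<forall>S S'. S \<inter> {..<N} = S' \<inter> {..<N} \<longrightarrow>
        measure torus2 {p. mix S p \<in> a i \<and> mix S' p \<notin> a i} < \<epsilon> / (2 * real (Suc m))"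
      by (rule allI, rule Union(2)) (use \<open>0 < \<epsilon>\<close> in simp)
    from choice[OF this] obtain N where N: "\<And>i S S'. S \<inter> {..<N i} = S' \<inter> {..<N i} \<Longrightarrow>
        measure torus2 {p. mix S p \<in> a i \<and> mix S' p \<notin> a i} < \<epsilon> / (2 * real (Suc m))"
      by blast
    define K where "K = (\<Sum>i<m. N i)"
    have "measure torus2 {p. mix S p \<in> \<Union>(range a) \<and> mix S' p \<notin> \<Union>(range a)} < \<epsilon>"
      if S: "S \<inter> {..<K} = S' \<inter> {..<K}" for S S'
    proof -
      let ?D = "\<lambda>i. {p. mix S p \<in> a i \<and> mix S' p \<notin> a i}"
      have D [measurable]: "?D i \<in> sets torus2" for i
        using sets.Diff[OF sets_mix_vimage[OF a, of S] sets_mix_vimage[OF a, of S']]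
        by (simp add: set_diff_eq)
      have RS: "{p. mix S p \<in> R m} \<in> sets torus2"
        by (rule sets_mix_vimage[OF R])
      have "measure torus2 {p. mix S p \<in> \<Union>(range a) \<and> mix S' p \<notin> \<Union>(range a)}
          \<le> measure torus2 ({p. mix S p \<in> R m} \<union> (\<Union>i<m. ?D i))"
        using D RS by (intro torus2.P.finite_measure_mono) (auto simp: R_def)
      also have "\<dots> \<le> measure torus2 {p. mix S p \<in> R m} + measure torus2 (\<Union>i<m. ?D i)"
        using D RS by (intro measure_Un_le) auto
      also have "measure torus2 (\<Union>i<m. ?D i) \<le> (\<Sum>i<m. measure torus2 (?D i))"
        using D by (intro torus2.P.finite_measure_subadditive_finite) auto
      also have "(\<Sum>i<m. measure torus2 (?D i)) \<le> (\<Sum>i<m. \<epsilon> / (2 * real (Suc m)))"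
      proof (intro sum_mono less_imp_le N)
        fix i assume "i \<in> {..<m}"
        then have "N i \<le> K" unfolding K_def by (intro member_le_sum) auto
        then have K: "V \<inter> {..<N i} = V \<inter> {..<K} \<inter> {..<N i}" for V by auto
        show "S \<inter> {..<N i} = S' \<inter> {..<N i}"
          by (rule trans[OF K trans[OF _ K[symmetric]]]) (simp only: S)
      qed
      also have "\<dots> \<le> \<epsilon> / 2" using \<open>0 < \<epsilon>\<close> by (simp add: field_simps)
      finally show ?thesis using m by (simp add: measure_mix_vimage)
    qed
    then show ?case by blast
  qed
qed

text \<open>The level sets of \<open>\<lfloor>g / \<delta>\<rfloor>\<close> reduce this to finitely many events up to small probability.\<close>

lemma mix_function_stable:
  fixes g :: "(nat \<Rightarrow> real) \<Rightarrow> real"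
  assumes g [measurable]: "g \<in> borel_measurable torus" and "0 < \<delta>" "0 < \<epsilon>"
  obtains N where "\<And>S S'. S \<inter> {..<N} = S' \<inter> {..<N} \<Longrightarrow>
    measure torus2 {p. \<delta> < \<bar>g (mix S p) - g (mix S' p)\<bar>} < \<epsilon>"
proof -
  define E where "E q = {z. \<lfloor>g z / \<delta>\<rfloor> = q}" for q
  define R where "R m = UNIV - (\<Union>q\<in>{- int m..int m}. E q)" for m :: nat
  have E: "E q \<in> sets torus" for q
  proof -
    have "{z \<in> space torus. \<lfloor>g z / \<delta>\<rfloor> = q} \<in> sets torus" by measurable
    then show ?thesis by (simp add: E_def)
  qed
  have R: "R m \<in> sets torus" for m
    using E sets.compl_sets[of "\<Union>q\<in>{- int m..int m}. E q" torus] by (simp add: R_def)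
  have "(\<lambda>m. measure torus (R m)) \<longlonglongrightarrow> measure torus (\<Inter>m. R m)"
    using R by (intro subtorus.finite_Lim_measure_decseq) (auto simp: decseq_def R_def)
  also have "(\<Inter>m. R m) = {}"
  proof -
    have "z \<notin> R (nat \<bar>\<lfloor>g z / \<delta>\<rfloor>\<bar>)" for z
      by (auto simp: R_def E_def)
    then show ?thesis by blast
  qed
  finally have "(\<lambda>m. measure torus (R m)) \<longlonglongrightarrow> 0" by simp
  then have "\<forall>\<^sub>F m in sequentially. measure torus (R m) < \<epsilon> / 2"
    using \<open>0 < \<epsilon>\<close> by (intro order_tendstoD(2)) auto
  then obtain m where m: "measure torus (R m) < \<epsilon> / 2"
    by (auto simp: eventually_sequentially)
  define Q where "Q = {- int m..int m}"
  have Q: "finite Q" "0 < card Q" by (auto simp: Q_def)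
  have "\<forall>q. \<exists>N. \<forall>S S'. S \<inter> {..<N} = S' \<inter> {..<N} \<longrightarrow>
      measure torus2 {p. mix S p \<in> E q \<and> mix S' p \<notin> E q} < \<epsilon> / (2 * real (card Q))"
    by (rule allI, rule mix_sets_stable[OF E]) (use \<open>0 < \<epsilon>\<close> Q in simp)
  from choice[OF this] obtain N where N: "\<And>q S S'. S \<inter> {..<N q} = S' \<inter> {..<N q} \<Longrightarrow>
      measure torus2 {p. mix S p \<in> E q \<and> mix S' p \<notin> E q} < \<epsilon> / (2 * real (card Q))"
    by blast
  define K where "K = (\<Sum>q\<in>Q. N q)"
  have "measure torus2 {p. \<delta> < \<bar>g (mix S p) - g (mix S' p)\<bar>} < \<epsilon>"
    if S: "S \<inter> {..<K} = S' \<inter> {..<K}" for S S'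
  proof -
    let ?D = "\<lambda>q. {p. mix S p \<in> E q \<and> mix S' p \<notin> E q}"
    have D: "?D q \<in> sets torus2" for q
      using sets.Diff[OF sets_mix_vimage[OF E, of S] sets_mix_vimage[OF E, of S']]
      by (simp add: set_diff_eq)
    have RS: "{p. mix S p \<in> R m} \<in> sets torus2"
      by (rule sets_mix_vimage[OF R])
    have close: "\<bar>s - t\<bar> \<le> \<delta>" if "\<lfloor>s / \<delta>\<rfloor> = \<lfloor>t / \<delta>\<rfloor>" for s t
    proof -
      have "\<bar>s / \<delta> - t / \<delta>\<bar> \<le> 1" using that by linarith
      then show ?thesis using \<open>0 < \<delta>\<close> by (simp add: diff_divide_distrib[symmetric] abs_divide)
    qed
    \<comment> \<open>A gap above \<delta> puts the two values in different cells. If the first cell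
      index lies in \<open>Q\<close>, one of finitely many separating events occurs; otherwise the
      first point lies in \<open>R m\<close>.\<close>
    have "{p. \<delta> < \<bar>g (mix S p) - g (mix S' p)\<bar>} \<subseteq> {p. mix S p \<in> R m} \<union> (\<Union>q\<in>Q. ?D q)"
    proof
      fix p assume p: "p \<in> {p. \<delta> < \<bar>g (mix S p) - g (mix S' p)\<bar>}"
      then have "\<lfloor>g (mix S p) / \<delta>\<rfloor> \<noteq> \<lfloor>g (mix S' p) / \<delta>\<rfloor>"
        using close[of "g (mix S p)" "g (mix S' p)"] by auto
      then have "p \<in> ?D \<lfloor>g (mix S p) / \<delta>\<rfloor>" by (simp add: E_def)
      moreover have "mix S p \<in> R m \<or> \<lfloor>g (mix S p) / \<delta>\<rfloor> \<in> Q"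
        unfolding R_def Q_def E_def by auto
      ultimately show "p \<in> {p. mix S p \<in> R m} \<union> (\<Union>q\<in>Q. ?D q)" by blast
    qed
    then have "measure torus2 {p. \<delta> < \<bar>g (mix S p) - g (mix S' p)\<bar>}
        \<le> measure torus2 ({p. mix S p \<in> R m} \<union> (\<Union>q\<in>Q. ?D q))"
      using D RS Q by (intro torus2.P.finite_measure_mono) auto
    also have "\<dots> \<le> measure torus2 {p. mix S p \<in> R m} + measure torus2 (\<Union>q\<in>Q. ?D q)"
      using D RS Q by (intro measure_Un_le) auto
    also have "measure torus2 (\<Union>q\<in>Q. ?D q) \<le> (\<Sum>q\<in>Q. measure torus2 (?D q))"
      using D Q by (intro torus2.P.finite_measure_subadditive_finite) auto
    also have "(\<Sum>q\<in>Q. measure torus2 (?D q)) \<le> (\<Sum>q\<in>Q. \<epsilon> / (2 * real (card Q)))"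
    proof (intro sum_mono less_imp_le N)
      fix q assume "q \<in> Q"
      then have "N q \<le> K" unfolding K_def using Q by (intro member_le_sum) auto
      then have K: "V \<inter> {..<N q} = V \<inter> {..<K} \<inter> {..<N q}" for V by auto
      show "S \<inter> {..<N q} = S' \<inter> {..<N q}"
        by (rule trans[OF K trans[OF _ K[symmetric]]]) (simp only: S)
    qed
    also have "\<dots> \<le> \<epsilon> / 2" using \<open>0 < \<epsilon>\<close> Q by (simp add: field_simps)
    finally show ?thesis using m by (simp add: measure_mix_vimage R)
  qed
  then show ?thesis by (rule that)
qed

section \<open>Arcs, boxes and distances between mixtures\<close>

lemma circ_dist_nonneg: "0 \<le> circ_dist s t"
  by (simp add: circ_dist_def)

lemma circ_dist_refl [simp]: "circ_dist s s = 0"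
  by (simp add: circ_dist_def)

lemma measurable_circ_dist [measurable]: "(\<lambda>t. circ_dist t s) \<in> borel_measurable borel"
  unfolding circ_dist_def frac_def by measurable

text \<open>An arc of length \<open>r\<close> on one side of \<open>s\<close> already suffices. Its
  side is chosen so that it does not wrap around the unit interval.\<close>

lemma emeasure_circ_arc:
  assumes "0 < r" "r \<le> 1/2"
  shows "ennreal r \<le> emeasure circ_measure {t. circ_dist t s < r}"
proof -
  define u where "u = frac s"
  have u: "0 \<le> u" "u < 1" by (simp_all add: u_def frac_lt_1)
  have frac: "frac (t - s) = frac (t - u)" "frac (s - t) = frac (u - t)" for t
  proof -
    have "t - u = t - s + of_int \<lfloor>s\<rfloor>" "u - t = s - t - of_int \<lfloor>s\<rfloor>"
      by (simp_all add: u_def frac_def)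
    then show "frac (t - s) = frac (t - u)" "frac (s - t) = frac (u - t)"
      by (simp_all only: frac_def floor_add_int[symmetric] floor_diff_of_int)
  qed
  \<comment> \<open>If the right-hand arc would leave the unit interval, then
    \<open>u > 1 - r\<close>, and \<open>r \<le> 1/2\<close> keeps the left-hand arc inside.\<close>
  define I where "I = (if u + r \<le> 1 then {u..<u+r} else {u-r<..<u})"
  have I: "I \<subseteq> circ" "I \<in> sets borel"
    using u assms by (auto simp: I_def circ_def)
  have "I \<subseteq> {t. circ_dist t s < r}"
  proof
    fix t assume "t \<in> I"
    then consider "0 \<le> t - u" "t - u < r" | "0 \<le> u - t" "u - t < r"
      by (auto simp: I_def split: if_splits)
    then show "t \<in> {t. circ_dist t s < r}"
      by cases (use assms in \<open>simp_all add: circ_dist_def frac min_less_iff_disj frac_eq[THEN iffD2]\<close>)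
  qed
  then have "emeasure circ_measure I \<le> emeasure circ_measure {t. circ_dist t s < r}"
    by (intro emeasure_mono) (simp_all add: sets_circ_measure)
  moreover have "emeasure circ_measure I = ennreal r"
  proof -
    have "emeasure circ_measure I = emeasure lborel (circ \<inter> I) / emeasure lborel circ"
      unfolding circ_measure_def using I by (intro emeasure_uniform_measure) (auto simp: circ_def)
    also have "circ \<inter> I = I" using I by blast
    also have "emeasure lborel I = ennreal r" using assms by (simp add: I_def)
    finally show ?thesis by (simp add: emeasure_lborel_circ divide_ennreal_def)
  qed
  ultimately show ?thesis by simp
qed

definition arc_box :: "nat set \<Rightarrow> (nat \<Rightarrow> real) \<Rightarrow> real \<Rightarrow> (nat \<Rightarrow> real) set" where
  "arc_box F y r = {z. \<forall>i\<in>F. circ_dist (z i) (y i) < r}"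

text \<open>The bound is uniform in the centre \<open>y\<close>, so a measurable set of measure
  below \<open>r ^ card F\<close> contains none of these boxes.\<close>

lemma emeasure_arc_box:
  assumes "finite F" "0 < r" "r \<le> 1/2"
  shows "ennreal (r ^ card F) \<le> emeasure torus (arc_box F y r)"
proof -
  have "ennreal (r ^ card F) = (\<Prod>i\<in>F. ennreal r)"
    using assms by (simp add: ennreal_power)
  also have "\<dots> \<le> (\<Prod>i\<in>F. emeasure circ_measure {t. circ_dist t (y i) < r})"
    using assms by (intro prod_mono_ennreal emeasure_circ_arc)
  also have "\<dots> = emeasure torus (arc_box F y r)"
    unfolding arc_box_def
    using emeasure_torus_cylinder[of F "\<lambda>i. {t. circ_dist t (y i) < r}"] assms by simp
  finally show ?thesis .
qed

text \<open>The two points differ only in coordinates from \<open>F\<close>, each time by less than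
  \<open>r\<close>. The square root of \<open>card F\<close> would do as factor;
  \<open>card F\<close> itself avoids the root.\<close>

lemma tdist_mix_le:
  assumes "finite F" "y \<in> arc_box F y' r" "0 \<le> r"
  shows "finite_tdist (mix F (x, y)) (mix F (x, y'))"
    and "tdist (mix F (x, y)) (mix F (x, y')) \<le> real (card F) * r"
proof -
  let ?h = "\<lambda>i. (circ_dist (mix F (x, y) i) (mix F (x, y') i))\<^sup>2"
  have zero: "?h i = 0" if "i \<notin> F" for i using that by (simp add: subtorus_emb_def)
  show "finite_tdist (mix F (x, y)) (mix F (x, y'))"
    unfolding finite_tdist_def using assms(1) zero by (rule summable_finite)
  have "(\<Sum>i. ?h i) = (\<Sum>i\<in>F. ?h i)"
    using assms(1) zero by (rule suminf_finite)
  also have "\<dots> \<le> (\<Sum>i\<in>F. r\<^sup>2)"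
    using assms by (intro sum_mono power_mono)
      (auto simp: subtorus_emb_def arc_box_def circ_dist_nonneg less_imp_le)
  also have "\<dots> = real (card F) * r\<^sup>2" by simp
  also have "\<dots> \<le> (real (card F))\<^sup>2 * r\<^sup>2"
    by (intro mult_right_mono) (auto simp: power2_eq_square mult_le_cancel_left1 simp flip: of_nat_mult)
  finally have "(\<Sum>i. ?h i) \<le> (real (card F) * r)\<^sup>2" by (simp add: power_mult_distrib)
  then show "tdist (mix F (x, y)) (mix F (x, y')) \<le> real (card F) * r"
    unfolding tdist_def using assms(3) by (intro real_le_lsqrt) auto
qed

section \<open>Almost sure properties on the torus and its subtori\<close>

text \<open>\<open>torus_measure A\<close> is the image of \<open>torus\<close> under restriction to
  \<open>A\<close>, and the embedding reads no coordinate outside \<open>A\<close>.\<close>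

lemma AE_subtorus:
  assumes P: "P \<in> sets torus" and "AE y in torus. subtorus_emb A b y \<in> P"
  shows "AE y in torus_measure A. subtorus_emb A b y \<in> P"
proof -
  have distr: "distr torus (torus_measure A) (\<lambda>y. restrict y A) = torus_measure A"
    using distr_PiM_reindex[of UNIV "\<lambda>_. circ_measure" "\<lambda>i. i" A] circ.prob_space_axioms
    by (simp add: torus_measure_def)
  have restr: "(\<lambda>y. restrict y A) \<in> torus \<rightarrow>\<^sub>M torus_measure A"
    unfolding torus_measure_def by (rule measurable_restrict_subset) simp
  have "subtorus_emb A b (restrict y A) = subtorus_emb A b y" for y
    by (auto simp: subtorus_emb_def)
  then have "AE y in distr torus (torus_measure A) (\<lambda>y. restrict y A). subtorus_emb A b y \<in> P"
    using assms(2) measurable_sets[OF measurable_subtorus_emb P, of A b]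
    by (subst AE_distr_iff[OF restr]) (simp_all add: vimage_def Int_def conj_commute)
  then show ?thesis by (simp only: distr)
qed

text \<open>Provides base points whose frozen coordinates lie in the circle.\<close>

lemma AE_torus_circ: "AE x in torus. \<forall>i. x i \<in> circ"
proof -
  have "AE t in circ_measure. t \<in> circ"
    unfolding circ_measure_def by (rule AE_uniform_measureI) (auto simp: circ_def)
  then have "AE x in torus. x i \<in> circ" for i
    unfolding torus_measure_def by (intro circ_prod.AE_component) auto
  then show ?thesis by (simp add: AE_all_countable)
qed

section \<open>Construction of an almost constant subtorus\<close>

text \<open>
  \<open>f\<close> is only measurable for the completed measure, so measure estimates are made for the Borel
  version \<open>g\<close>, while the Lipschitz bound holds pointwise for \<open>f\<close> alone.
\<close>

locale torus_lipschitz_version =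
  fixes f g :: "(nat \<Rightarrow> real) \<Rightarrow> real" and Z :: "(nat \<Rightarrow> real) set" and L :: real
  assumes g [measurable]: "g \<in> borel_measurable torus"
    and Z: "Z \<in> null_sets torus"
    and f_eq_g: "z \<notin> Z \<Longrightarrow> f z = g z"
    and L: "0 \<le> L"
    and lipschitz: "finite_tdist x y \<Longrightarrow> \<bar>f x - f y\<bar> \<le> L * tdist x y"
begin

lemma measurable_g_mix [measurable]: "(\<lambda>p. g (mix S p)) \<in> borel_measurable torus2"
  by measurable

lemma sets_gap: "{p. \<delta> < \<bar>g (mix S p) - g (mix S' p)\<bar>} \<in> sets torus2"
proof -
  have "{p \<in> space torus2. \<delta> < \<bar>g (mix S p) - g (mix S' p)\<bar>} \<in> sets torus2" by measurable
  then show ?thesis by simp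
qed

text \<open>For large \<open>n\<close> the mixtures over \<open>F\<close> and
  \<open>insert n F\<close> have close values with high probability. By Markov's inequality, for
  most \<open>x\<close> the exceptional \<open>y\<close> have measure below that of any small box.
  So every \<open>y\<close> has an unexceptional \<open>y'\<close> nearby in the relevant
  coordinates, and the Lipschitz bound carries the estimate from \<open>y'\<close> to
  \<open>y\<close>.\<close>

lemma add_coordinate:
  assumes F: "finite F" and \<eta>: "0 < \<eta>" and e: "0 < e"
  shows "\<exists>n G. n \<notin> F \<and> G \<in> sets torus \<and> measure torus (UNIV - G) \<le> e \<and>
    (\<forall>x\<in>G. \<forall>y. \<bar>f (mix (insert n F) (x, y)) - f (mix F (x, y))\<bar> \<le> \<eta>)"
proof -
  define c where "c = Suc (card F)"
  \<comment> \<open>Moving up to \<open>c\<close> coordinates by \<open>r\<close> shall change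
    \<open>f\<close> by at most \<eta>/4. The factor \<open>L + 1\<close> covers
    \<open>L = 0\<close>, and the cap 1/2 meets the hypothesis of the arc estimate.\<close>
  define r where "r = min (1/2) (\<eta> / (4 * (L + 1) * real c))"
  have c: "0 < c" by (simp add: c_def)
  have r: "0 < r" "r \<le> 1/2"
    unfolding r_def using \<eta> L c by (simp, intro min.cobounded1)
  have "r \<le> \<eta> / (4 * (L + 1) * real c)" by (simp add: r_def)
  then have "r * (4 * (L + 1) * real c) \<le> \<eta>"
    using L c by (subst (asm) pos_le_divide_eq) auto
  then have "(L + 1) * (real c * r) \<le> \<eta> / 4" by (simp add: algebra_simps)
  moreover have "L * (real c * r) \<le> (L + 1) * (real c * r)" using r by (intro mult_right_mono) auto
  ultimately have Lr: "L * (real c * r) \<le> \<eta> / 4" by linarith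
  \<comment> \<open>A lower bound for the measure of every box in \<open>c\<close> coordinates. It
    can be fixed before \<open>n\<close>, since \<open>insert n F\<close> has \<open>c\<close>
    elements for every new \<open>n\<close>.\<close>
  define d where "d = r ^ c"
  have d: "0 < d" using r by (simp add: d_def)
  obtain N where N: "\<And>S S'. S \<inter> {..<N} = S' \<inter> {..<N} \<Longrightarrow>
      measure torus2 {p. \<eta> / 2 < \<bar>g (mix S p) - g (mix S' p)\<bar>} < e * d"
    using mix_function_stable[OF g, of "\<eta> / 2" "e * d"] \<eta> e d by auto
  obtain n where n: "n \<notin> F \<union> {..<N}"
    using ex_new_if_finite[of "F \<union> {..<N}"] F by auto
  let ?F = "insert n F"
  \<comment> \<open>The null parts are included so that off \<open>B\<close> both mixed points avoid
    \<open>Z\<close>, where \<open>f\<close> and \<open>g\<close> may differ.\<close>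
  define B where "B = {p. \<eta> / 2 < \<bar>g (mix ?F p) - g (mix F p)\<bar>} \<union>
    ({p. mix ?F p \<in> Z} \<union> {p. mix F p \<in> Z})"
  have null: "{p. mix ?F p \<in> Z} \<union> {p. mix F p \<in> Z} \<in> null_sets torus2"
    using Z by (intro null_sets.Un null_sets_mix_vimage)
  have B [measurable]: "B \<in> sets torus2"
    unfolding B_def by (intro sets.Un[OF sets_gap] null_setsD2[OF null])
  have "?F \<inter> {..<N} = F \<inter> {..<N}" using n by auto
  then have "measure torus2 {p. \<eta> / 2 < \<bar>g (mix ?F p) - g (mix F p)\<bar>} < e * d" by (rule N)
  then have mB: "measure torus2 B < e * d"
    unfolding B_def measure_Un_null_set[OF sets_gap null] .
  define h where "h x = emeasure torus (Pair x -` B)" for x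
  have h: "h \<in> borel_measurable torus"
    unfolding h_def by (rule subtorus.measurable_emeasure_Pair[OF B])
  define G where "G = {x. h x < ennreal d}"
  have G: "G \<in> sets torus"
  proof -
    have "{x \<in> space torus. h x < ennreal d} \<in> sets torus" using h by measurable
    then show ?thesis by (simp add: G_def)
  qed
  then have G': "UNIV - G \<in> sets torus"
    using sets.compl_sets[of G torus] by simp
  have "ennreal d * emeasure torus (UNIV - G) = (\<integral>\<^sup>+x. ennreal d * indicator (UNIV - G) x \<partial>torus)"
    using G' by (simp add: nn_integral_cmult_indicator)
  also have "\<dots> \<le> (\<integral>\<^sup>+x. h x \<partial>torus)"
    by (intro nn_integral_mono) (auto simp: G_def not_less split: split_indicator)
  also have "\<dots> = emeasure torus2 B"
    unfolding h_def by (rule subtorus.emeasure_pair_measure_alt[OF B, symmetric])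
  finally have "ennreal (d * measure torus (UNIV - G)) \<le> ennreal (measure torus2 B)"
    using d by (simp add: subtorus.emeasure_eq_measure torus2.P.emeasure_eq_measure ennreal_mult)
  then have "d * measure torus (UNIV - G) \<le> measure torus2 B" by simp
  with mB have "d * measure torus (UNIV - G) \<le> d * e" by (simp add: mult.commute)
  then have mG: "measure torus (UNIV - G) \<le> e" using d by simp
  have "\<bar>f (mix ?F (x, y)) - f (mix F (x, y))\<bar> \<le> \<eta>" if x: "x \<in> G" for x y
  proof -
    have "\<not> arc_box ?F y r \<subseteq> Pair x -` B"
    proof
      assume "arc_box ?F y r \<subseteq> Pair x -` B"
      then have "emeasure torus (arc_box ?F y r) \<le> h x"
        unfolding h_def using B by (intro emeasure_mono) (auto intro: sets_Pair1)
      moreover have "ennreal d \<le> emeasure torus (arc_box ?F y r)"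
        using emeasure_arc_box[of ?F r y] F n r by (simp add: d_def c_def)
      ultimately show False using x by (auto simp: G_def)
    qed
    then obtain y' where y': "y' \<in> arc_box ?F y r" "(x, y') \<notin> B" by auto
    have y'F: "y' \<in> arc_box F y r" using y'(1) by (simp add: arc_box_def)
    have "\<bar>f (mix S (x, y')) - f (mix S (x, y))\<bar> \<le> \<eta> / 4"
      if S: "finite S" "card S \<le> c" "y' \<in> arc_box S y r" for S
    proof -
      have "\<bar>f (mix S (x, y')) - f (mix S (x, y))\<bar> \<le> L * tdist (mix S (x, y')) (mix S (x, y))"
        by (rule lipschitz[OF tdist_mix_le(1)[OF S(1,3)]]) (simp add: r less_imp_le)
      also have "\<dots> \<le> L * (real (card S) * r)"
        by (rule mult_left_mono[OF tdist_mix_le(2)[OF S(1,3)] L]) (simp add: r less_imp_le)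
      also have "\<dots> \<le> L * (real c * r)"
        using S L r by (intro mult_left_mono mult_right_mono) auto
      finally show ?thesis using Lr by simp
    qed
    from this[of ?F] this[of F]
    have "\<bar>f (mix ?F (x, y')) - f (mix ?F (x, y))\<bar> \<le> \<eta> / 4"
      "\<bar>f (mix F (x, y')) - f (mix F (x, y))\<bar> \<le> \<eta> / 4"
      using F n y'(1) y'F by (auto simp: c_def)
    moreover have "\<bar>f (mix ?F (x, y')) - f (mix F (x, y'))\<bar> \<le> \<eta> / 2"
      using y'(2) by (simp add: B_def f_eq_g)
    ultimately show ?thesis by linarith
  qed
  then show ?thesis using n G mG by blast
qed

text \<open>The mixtures over the sets \<open>F k\<close> approximate the mixture over
  \<open>A\<close> in probability, as these sets agree with \<open>A\<close> on arbitrarily long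
  initial segments. The bound \<epsilon>/2 for every \<open>k\<close> survives in the limit at the
  cost of another \<epsilon>/2.\<close>

lemma AE_mix_limit:
  assumes "\<And>N. \<exists>k. F k \<inter> {..<N} = A \<inter> {..<N}" and "0 < \<epsilon>"
    and near: "\<And>k x y. x \<in> W \<Longrightarrow> \<bar>f (mix (F k) (x, y)) - f x\<bar> \<le> \<epsilon> / 2"
    and W: "W \<in> sets torus"
  shows "AE p in torus2. fst p \<in> W \<longrightarrow> \<bar>g (mix A p) - g (fst p)\<bar> \<le> \<epsilon>"
proof -
  have base: "mix {} p = fst p" for p by (simp add: subtorus_emb_def)
  define V where "V = {p. mix {} p \<in> W} \<inter> {p. \<epsilon> < \<bar>g (mix A p) - g (mix {} p)\<bar>}"
  have V: "V \<in> sets torus2"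
    unfolding V_def by (intro sets.Int sets_mix_vimage[OF W] sets_gap)
  have "measure torus2 V \<le> 0 + e" if "0 < e" for e
  proof -
    obtain N where N: "\<And>S S'. S \<inter> {..<N} = S' \<inter> {..<N} \<Longrightarrow>
        measure torus2 {p. \<epsilon> / 2 < \<bar>g (mix S p) - g (mix S' p)\<bar>} < e"
      using mix_function_stable[OF g, of "\<epsilon> / 2" e] \<open>0 < \<epsilon>\<close> \<open>0 < e\<close> by auto
    obtain k where k: "F k \<inter> {..<N} = A \<inter> {..<N}" using assms(1) by blast
    let ?B = "{p. \<epsilon> / 2 < \<bar>g (mix (F k) p) - g (mix A p)\<bar>}"
    let ?Z = "{p. mix (F k) p \<in> Z} \<union> {p. mix {} p \<in> Z}"
    have null: "?Z \<in> null_sets torus2"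
      using Z by (intro null_sets.Un null_sets_mix_vimage)
    have "V \<subseteq> ?B \<union> ?Z"
    proof
      fix p assume p: "p \<in> V"
      show "p \<in> ?B \<union> ?Z"
      proof (cases "p \<in> ?Z")
        case False
        have "\<bar>f (mix (F k) p) - f (fst p)\<bar> \<le> \<epsilon> / 2"
          using near[of "fst p" k "snd p"] p by (simp add: V_def base)
        then have "\<bar>g (mix (F k) p) - g (fst p)\<bar> \<le> \<epsilon> / 2"
          using False by (simp add: base f_eq_g)
        moreover have "\<epsilon> < \<bar>g (mix A p) - g (fst p)\<bar>" using p by (simp add: V_def base)
        ultimately have "\<epsilon> / 2 < \<bar>g (mix (F k) p) - g (mix A p)\<bar>" by linarith
        then show ?thesis by simp
      qed simp
    qed
    then have "measure torus2 V \<le> measure torus2 (?B \<union> ?Z)"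
      by (intro torus2.P.finite_measure_mono sets.Un[OF sets_gap] null_setsD2[OF null])
    also have "\<dots> = measure torus2 ?B" by (rule measure_Un_null_set[OF sets_gap null])
    also have "\<dots> < e" by (rule N[OF k])
    finally show ?thesis by simp
  qed
  then have "measure torus2 V \<le> 0" by (rule field_le_epsilon)
  then have "V \<in> null_sets torus2"
    using V by (simp add: null_sets_def torus2.P.emeasure_eq_measure measure_le_0_iff)
  then have "AE p in torus2. p \<notin> V" by (rule AE_not_in)
  then show ?thesis by eventually_elim (auto simp: V_def base)
qed

text \<open>Adding coordinates with summable errors leaves at least half of all \<open>x\<close>
  with total change at most \<epsilon>/2. As \<open>\<bar>g\<bar> \<le> R\<close> on more than half,
  a common base point exists, and its value is the constant. The bound \<open>R\<close> on it makes
  the later compactness argument possible.\<close>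

lemma exists_almost_constant_subtorus:
  assumes \<epsilon>: "0 < \<epsilon>" and R: "1/2 < measure torus {z. \<bar>g z\<bar> \<le> R}"
  shows "\<exists>A b a. infinite A \<and> (\<forall>i. b i \<in> circ) \<and> \<bar>a\<bar> \<le> R \<and>
    (AE y in torus_measure A. \<bar>f (subtorus_emb A b y) - a\<bar> \<le> \<epsilon>)"
proof -
  \<comment> \<open>The errors \<open>\<eta> k\<close> sum to \<epsilon>/2, leaving \<epsilon>/2 for
    the passage to the limit set; the \<open>e k\<close> sum to 1/2.\<close>
  define \<eta> where "\<eta> k = \<epsilon> / 2 * (1/2) ^ Suc k" for k
  define e where "e k = 1 / 2 * (1/2::real) ^ Suc k" for k
  have pos: "0 < \<eta> k" "0 < e k" for k using \<epsilon> by (simp_all add: \<eta>_def e_def)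
  define Q where "Q k F n G \<longleftrightarrow> n \<notin> F \<and> G \<in> sets torus \<and> measure torus (UNIV - G) \<le> e k \<and>
    (\<forall>x\<in>G. \<forall>y. \<bar>f (mix (insert n F) (x, y)) - f (mix F (x, y))\<bar> \<le> \<eta> k)" for k F n G
  have ex: "\<exists>n G. Q k F n G" if "finite F" for k F
    unfolding Q_def by (rule add_coordinate[OF that pos])
  \<comment> \<open>The index depends on \<open>k\<close> and \<open>F\<close> alone, so the
    recursion for \<open>F\<close> need not carry the good sets.\<close>
  define n where "n k F = (SOME n. \<exists>G. Q k F n G)" for k F
  define G where "G k F = (SOME G. Q k F (n k F) G)" for k F
  have step: "Q k F (n k F) (G k F)" if "finite F" for k F
    unfolding G_def n_def by (rule someI_ex[OF someI_ex[OF ex[OF that]]])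
  define F where "F = rec_nat {} (\<lambda>k F. insert (n k F) F)"
  have F_0: "F 0 = {}" and F_Suc: "F (Suc k) = insert (n k (F k)) (F k)" for k
    by (simp_all add: F_def)
  have fin: "finite (F k)" for k by (induction k) (simp_all add: F_0 F_Suc)
  define G' where "G' k = G k (F k)" for k
  have new: "n k (F k) \<notin> F k" and G: "G' k \<in> sets torus" "measure torus (UNIV - G' k) \<le> e k"
    and move: "x \<in> G' k \<Longrightarrow> \<bar>f (mix (F (Suc k)) (x, y)) - f (mix (F k) (x, y))\<bar> \<le> \<eta> k" for k x y
    using step[OF fin[of k], of k] by (auto simp: Q_def G'_def F_Suc)
  have card: "card (F k) = k" for k
    by (induction k) (simp_all add: F_0 F_Suc fin new)
  have mono: "incseq F" by (rule incseq_SucI) (auto simp: F_Suc)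
  define A where "A = (\<Union>k. F k)"
  have "infinite A"
  proof
    assume "finite A"
    then have "card (F (Suc (card A))) \<le> card A" by (rule card_mono) (auto simp: A_def)
    then show False by (simp add: card)
  qed
  have agree: "\<exists>k. F k \<inter> {..<N} = A \<inter> {..<N}" for N
  proof -
    have "finite (A \<inter> {..<N})" "A \<inter> {..<N} \<subseteq> \<Union>(range F)" by (auto simp: A_def)
    then obtain k where "A \<inter> {..<N} \<subseteq> F k"
    proof (rule finite_subset_Union_chain[of _ _ UNIV])
      have "F i \<subseteq> F j \<or> F j \<subseteq> F i" for i j
        using incseqD[OF mono, of i j] incseqD[OF mono, of j i] by (meson linear)
      then show "subset.chain UNIV (range F)" by (auto simp: subset_chain_def)
    qed auto
    then show ?thesis by (intro exI[of _ k]) (auto simp: A_def)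
  qed
  define W0 where "W0 = (\<Inter>k. G' k)"
  have W0: "W0 \<in> sets torus" using G by (auto simp: W0_def)
  have near: "\<bar>f (mix (F k) (x, y)) - f x\<bar> \<le> \<epsilon> / 2" if "x \<in> W0" for k x y
  proof -
    have "\<bar>f (mix (F k) (x, y)) - f x\<bar> \<le> \<epsilon> / 2 * (1 - (1/2) ^ k)"
    proof (induction k)
      case 0
      then show ?case by (simp add: F_0 subtorus_emb_def)
    next
      case (Suc k)
      have "\<bar>f (mix (F (Suc k)) (x, y)) - f (mix (F k) (x, y))\<bar> \<le> \<eta> k"
        using that by (intro move) (auto simp: W0_def)
      moreover have "\<epsilon> / 2 * (1 - (1/2) ^ k) + \<eta> k = \<epsilon> / 2 * (1 - (1/2) ^ Suc k)"
        by (simp add: \<eta>_def field_simps)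
      ultimately show ?case using Suc by linarith
    qed
    also have "\<dots> \<le> \<epsilon> / 2" using \<epsilon> by simp
    finally show ?thesis .
  qed
  have e_sums: "e sums (1/2)"
    using sums_mult[OF power_half_series, of "1/2"] by (simp add: e_def[abs_def])
  have W0_compl: "UNIV - W0 = (\<Union>k. UNIV - G' k)" by (auto simp: W0_def)
  have sets_G'_compl: "UNIV - G' k \<in> sets torus" for k
    using sets.compl_sets[OF G(1)] by simp
  have summ: "summable (\<lambda>k. measure torus (UNIV - G' k))"
    using G(2) by (intro summable_comparison_test'[OF sums_summable[OF e_sums], of 0]) simp
  have "measure torus (UNIV - W0) \<le> (\<Sum>k. measure torus (UNIV - G' k))"
    unfolding W0_compl using sets_G'_compl summ
    by (intro subtorus.finite_measure_subadditive_countably) auto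
  also have "\<dots> \<le> (\<Sum>k. e k)"
    by (intro suminf_le G(2) summ sums_summable[OF e_sums])
  also have "\<dots> = 1/2" using e_sums by (simp add: sums_iff)
  finally have mW0: "measure torus (UNIV - W0) \<le> 1/2" .
  define Y where "Y = {z. \<bar>g z\<bar> \<le> R}"
  have Y: "Y \<in> sets torus"
  proof -
    have "{z \<in> space torus. \<bar>g z\<bar> \<le> R} \<in> sets torus" by measurable
    then show ?thesis by (simp add: Y_def)
  qed
  have "measure torus Y \<le> measure torus (Y \<inter> W0) + measure torus (UNIV - W0)"
    using Y W0 sets.compl_sets[OF W0]
    by (intro order_trans[OF _ measure_Un_le] subtorus.finite_measure_mono) auto
  then have YW: "0 < measure torus (Y \<inter> W0)" using R mW0 by (simp add: Y_def)
  have "AE p in torus2. fst p \<in> W0 \<longrightarrow> \<bar>g (mix A p) - g (fst p)\<bar> \<le> \<epsilon>"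
    by (rule AE_mix_limit[OF agree \<epsilon> near W0])
  moreover have "AE p in torus2. mix A p \<notin> Z"
    using AE_not_in[OF null_sets_mix_vimage[OF Z, of A]] by simp
  ultimately have "AE p in torus2.
      fst p \<in> W0 \<longrightarrow> \<bar>g (mix A p) - g (fst p)\<bar> \<le> \<epsilon> \<and> mix A p \<notin> Z"
    by eventually_elim simp
  then have "AE x in torus. AE y in torus.
      x \<in> W0 \<longrightarrow> \<bar>g (subtorus_emb A x y) - g x\<bar> \<le> \<epsilon> \<and> subtorus_emb A x y \<notin> Z"
    using torus2.AE_pair by force
  with AE_torus_circ have ae: "AE x in torus. (\<forall>i. x i \<in> circ) \<and> (AE y in torus.
      x \<in> W0 \<longrightarrow> \<bar>g (subtorus_emb A x y) - g x\<bar> \<le> \<epsilon> \<and> subtorus_emb A x y \<notin> Z)"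
    by eventually_elim simp
  have "\<exists>x\<in>Y \<inter> W0. (\<forall>i. x i \<in> circ) \<and> (AE y in torus.
      x \<in> W0 \<longrightarrow> \<bar>g (subtorus_emb A x y) - g x\<bar> \<le> \<epsilon> \<and> subtorus_emb A x y \<notin> Z)"
  proof (rule ccontr)
    assume neg: "\<not> ?thesis"
    from ae have "AE x in torus. x \<notin> Y \<inter> W0" by (rule eventually_mono) (use neg in blast)
    then have "Y \<inter> W0 \<in> null_sets torus"
      using Y W0 by (subst AE_iff_null_sets) auto
    then show False using YW by (simp add: null_sets_def measure_def)
  qed
  then obtain x where x: "x \<in> Y" "x \<in> W0" "\<forall>i. x i \<in> circ"
    and aex: "AE y in torus. \<bar>g (subtorus_emb A x y) - g x\<bar> \<le> \<epsilon> \<and> subtorus_emb A x y \<notin> Z"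
    by auto
  \<comment> \<open>Removing \<open>Z\<close> turns the bound on \<open>g\<close> into one on
    \<open>f\<close> while keeping \<open>P\<close> measurable for \<open>torus\<close>.\<close>
  define P where "P = {z. \<bar>g z - g x\<bar> \<le> \<epsilon>} - Z"
  have P: "P \<in> sets torus"
  proof -
    have "{z \<in> space torus. \<bar>g z - g x\<bar> \<le> \<epsilon>} \<in> sets torus" by measurable
    then show ?thesis using null_setsD2[OF Z] by (simp add: P_def sets.Diff)
  qed
  have "AE y in torus_measure A. subtorus_emb A x y \<in> P"
    using aex by (intro AE_subtorus[OF P]) (simp add: P_def)
  then have "AE y in torus_measure A. \<bar>f (subtorus_emb A x y) - g x\<bar> \<le> \<epsilon>"
    by eventually_elim (simp add: P_def f_eq_g)
  then show ?thesis using \<open>infinite A\<close> x by (auto simp: Y_def)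
qed

end

section \<open>Compactness and the limiting constant\<close>

theorem theorem1:
  fixes f :: "(nat \<Rightarrow> real) \<Rightarrow> real"
  assumes "f \<in> borel_measurable sigma_T"
    and "torus_lipschitz f"
  shows "\<exists>a::real. \<forall>\<epsilon>>0. \<exists>A b. infinite A \<and> (\<forall>i. i \<notin> A \<longrightarrow> b i \<in> circ) \<and>
           linf_subtorus_less A b (\<lambda>x. f x - a) \<epsilon>"
proof -
  obtain g where g [measurable]: "g \<in> borel_measurable torus" and "AE z in torus. f z = g z"
    using completion_ex_borel_measurable_real[of f torus] assms(1) by (auto simp: sigma_T_def)
  then obtain Z where Z: "Z \<in> null_sets torus" "{z \<in> space torus. f z \<noteq> g z} \<subseteq> Z"
    by (auto simp: eventually_ae_filter)
  obtain L where L: "\<And>x y. finite_tdist x y \<Longrightarrow> \<bar>f x - f y\<bar> \<le> L * tdist x y"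
    using assms(2) by (auto simp: torus_lipschitz_def sigma_T_def)
  \<comment> \<open>Passing to \<open>\<bar>L\<bar>\<close> gives nonnegativity without exhibiting
    two points at positive finite distance.\<close>
  interpret torus_lipschitz_version f g Z "\<bar>L\<bar>"
  proof
    fix x y assume xy: "finite_tdist x y"
    then have "0 \<le> tdist x y" by (auto simp: tdist_def finite_tdist_def intro!: suminf_nonneg)
    then have "L * tdist x y \<le> \<bar>L\<bar> * tdist x y" by (intro mult_right_mono) auto
    with L[OF xy] show "\<bar>f x - f y\<bar> \<le> \<bar>L\<bar> * tdist x y" by linarith
  qed (use g Z in auto)
  \<comment> \<open>\<open>g\<close> is real valued, so these sets exhaust the space; the bound
    \<open>m\<close> is fixed before any \<epsilon>.\<close>
  have "(\<lambda>m. measure torus {z. \<bar>g z\<bar> \<le> real m}) \<longlonglongrightarrow> measure torus (\<Union>m. {z. \<bar>g z\<bar> \<le> real m})"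
  proof (rule subtorus.finite_Lim_measure_incseq)
    have "{z \<in> space torus. \<bar>g z\<bar> \<le> real m} \<in> sets torus" for m by measurable
    then show "range (\<lambda>m. {z. \<bar>g z\<bar> \<le> real m}) \<subseteq> sets torus" by auto
  qed (auto simp: incseq_def)
  also have "(\<Union>m. {z. \<bar>g z\<bar> \<le> real m}) = space torus"
    using real_arch_simple by auto
  finally have "(\<lambda>m. measure torus {z. \<bar>g z\<bar> \<le> real m}) \<longlonglongrightarrow> 1"
    by (simp only: subtorus.prob_space)
  then have "\<forall>\<^sub>F m in sequentially. 1/2 < measure torus {z. \<bar>g z\<bar> \<le> real m}"
    by (rule order_tendstoD(1)) simp
  then obtain m where m: "1/2 < measure torus {z. \<bar>g z\<bar> \<le> real m}"
    by (auto simp: eventually_sequentially)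
  have "\<forall>k. \<exists>a A b. infinite A \<and> (\<forall>i. b i \<in> circ) \<and> \<bar>a\<bar> \<le> real m \<and>
      (AE y in torus_measure A. \<bar>f (subtorus_emb A b y) - a\<bar> \<le> inverse (real (Suc k)))"
    using exists_almost_constant_subtorus[OF _ m]
    by (metis inverse_positive_iff_positive of_nat_0_less_iff zero_less_Suc)
  from choice[OF this] obtain a where a: "\<And>k. \<exists>A b. infinite A \<and> (\<forall>i. b i \<in> circ) \<and>
      \<bar>a k\<bar> \<le> real m \<and>
      (AE y in torus_measure A. \<bar>f (subtorus_emb A b y) - a k\<bar> \<le> inverse (real (Suc k)))"
    by blast
  \<comment> \<open>All constants lie in one compact interval, so a subsequence converges; its limit
    works for every \<epsilon>.\<close>
  have "bounded (range a)"
    using a by (intro boundedI[of _ "real m"]) auto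
  then obtain l s where s: "strict_mono s" and lim: "(a \<circ> s) \<longlonglongrightarrow> l"
    using bounded_imp_convergent_subsequence by blast
  have "\<exists>A b. infinite A \<and> (\<forall>i. i \<notin> A \<longrightarrow> b i \<in> circ) \<and> linf_subtorus_less A b (\<lambda>x. f x - l) \<epsilon>"
    if \<epsilon>: "0 < \<epsilon>" for \<epsilon>
  proof -
    have "\<forall>\<^sub>F k in sequentially. dist ((a \<circ> s) k) l < \<epsilon> / 3"
      using \<epsilon> by (intro tendstoD[OF lim]) simp
    moreover have "\<forall>\<^sub>F k in sequentially. inverse (real (Suc k)) < \<epsilon> / 3"
      using LIMSEQ_inverse_real_of_nat \<epsilon> by (intro order_tendstoD(2)) auto
    ultimately have "\<forall>\<^sub>F k in sequentially. dist ((a \<circ> s) k) l < \<epsilon> / 3 \<and> inverse (real (Suc k)) < \<epsilon> / 3"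
      by eventually_elim simp
    then obtain k where k: "\<bar>a (s k) - l\<bar> < \<epsilon> / 3" "inverse (real (Suc k)) < \<epsilon> / 3"
      by (auto simp: eventually_sequentially dist_real_def)
    have "inverse (real (Suc (s k))) \<le> inverse (real (Suc k))"
      using seq_suble[OF s, of k] by (intro le_imp_inverse_le) auto
    with k(2) have k': "inverse (real (Suc (s k))) < \<epsilon> / 3" by linarith
    obtain A b where Ab: "infinite A" "\<forall>i. b i \<in> circ"
      "AE y in torus_measure A. \<bar>f (subtorus_emb A b y) - a (s k)\<bar> \<le> inverse (real (Suc (s k)))"
      using a by blast
    \<comment> \<open>Two errors below \<epsilon>/3 give the bound 2\<epsilon>/3, which leaves the
      strict gap to \<epsilon> demanded by \<open>linf_subtorus_less\<close>.\<close>
    from Ab(3) have "AE y in torus_measure A. \<bar>f (subtorus_emb A b y) - l\<bar> \<le> 2 * \<epsilon> / 3"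
      by eventually_elim (use k(1) k' in linarith)
    then have "linf_subtorus_less A b (\<lambda>x. f x - l) \<epsilon>"
      unfolding linf_subtorus_less_def using \<epsilon>
      by (intro exI[of _ "2 * \<epsilon> / 3"] conjI AE_completion) auto
    then show ?thesis using Ab by blast
  qed
  then show ?thesis by blast
qed

end
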